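(* Consider the constrained problem $$\min_{x\in\mathbb R^n} f(x)\quad\text{subject to } c_i(x)=0\ (i\in\mathcal E),\quad c_i(x)\ge 0\ (i\in\mathcal I),$$ with feasible set $\Omega$. Let $x^\ast\in\Omega$ be a feasible point, and suppose that every inactive constraint function $c_i$, $i\in\mathcal I\setminus\mathcal A(x^\ast)$, is continuously differentiable at $x^\ast$. If the linear constraint qualification holds at $x^\ast$, then $\mathcal F(x^\ast)=T_\Omega(x^\ast)$.
   Context: Setting: $\mathcal E$ and $\mathcal I$ are disjoint finite index sets, and $f:\mathbb R^n\to\mathbb R$ and $c_i:\mathbb R^n\to\mathbb R$ ($i\in\mathcal E\cup\mathcal I$) are real-valued functions. The feasible set is $\Omega=\{x\in\mathbb R^n : c_i(x)=0\ \forall i\in\mathcal E,\ c_i(x)\ge 0\ \forall i\in\mathcal I\}$. "Continuously differentiable at $x^\ast$" means $C^1$ in a neighborhood of $x^\ast$. Tangent cone: a vector $d$ is a tangent vector to $\Omega$ at $x$ if there exist a feasible sequence $\{z_k\}$ (that is, $z_k\in\Omega$ for all sufficiently large $k$) converging to $x$ and a sequence of positive scalars $t_k\to 0$ with $\lim_{k\to\infty}(z_k-x)/t_k=d$. The set of all tangent vectors to $\Omega$ at $x$ is denoted $T_\Omega(x)$. Active set: for feasible $x$, $\mathcal A(x)=\mathcal E\cup\{i\in\mathcal I : c_i(x)=0\}$. Linearized feasible directions: $\mathcal F(x)=\{d\in\mathbb R^n : d^\top\nabla c_i(x)=0\ \forall i\in\mathcal E,\ d^\top\nabla c_i(x)\ge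 0\ \forall i\in\mathcal A(x)\cap\mathcal I\}$. The linear constraint qualification holds at $x$ if all active constraints are (affine) linear functions: for every $i\in\mathcal A(x)$ there exist $a_i\in\mathbb R^n$ and $b_i\in\mathbb R$ such that $c_i(y)=a_i^\top y+b_i$ for all $y\in\mathbb R^n$. *)

theory Defs
  imports "HOL-Analysis.Analysis"
begin

(* The gradient is the vector D with Frechet derivative h \<mapsto> h \<bullet> D; it is meaningful only
   where g is differentiable. *)
definition gradient :: "(real ^ 'n \<Rightarrow> real) \<Rightarrow> real ^ 'n \<Rightarrow> real ^ 'n" where
  "gradient g x = (THE D. GDERIV g x :> D)"

definition continuously_differentiable_at :: "(real ^ 'n \<Rightarrow> real) \<Rightarrow> real ^ 'n \<Rightarrow> bool" where
  "continuously_differentiable_at g x \<longleftrightarrow>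
     (\<exists>U. open U \<and> x \<in> U \<and> (\<forall>y\<in>U. g differentiable (at y)) \<and> continuous_on U (gradient g))"

definition feasible_set :: "'i set \<Rightarrow> 'i set \<Rightarrow> ('i \<Rightarrow> real ^ 'n \<Rightarrow> real) \<Rightarrow> (real ^ 'n) set" where
  "feasible_set E I c = {x. (\<forall>i\<in>E. c i x = 0) \<and> (\<forall>i\<in>I. c i x \<ge> 0)}"

definition tangent_cone :: "(real ^ 'n) set \<Rightarrow> real ^ 'n \<Rightarrow> (real ^ 'n) set" where
  "tangent_cone \<Omega> x =
     {d. \<exists>(z :: nat \<Rightarrow> real ^ 'n) (t :: nat \<Rightarrow> real).
           (\<forall>\<^sub>F k in sequentially. z k \<in> \<Omega>) \<and> z \<longlonglongrightarrow> x \<and>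
           (\<forall>k. t k > 0) \<and> t \<longlonglongrightarrow> 0 \<and>
           (\<lambda>k. (z k - x) /\<^sub>R t k) \<longlonglongrightarrow> d}"

definition active_set :: "'i set \<Rightarrow> 'i set \<Rightarrow> ('i \<Rightarrow> real ^ 'n \<Rightarrow> real) \<Rightarrow> real ^ 'n \<Rightarrow> 'i set" where
  "active_set E I c x = E \<union> {i\<in>I. c i x = 0}"

definition linearized_directions ::
  "'i set \<Rightarrow> 'i set \<Rightarrow> ('i \<Rightarrow> real ^ 'n \<Rightarrow> real) \<Rightarrow> real ^ 'n \<Rightarrow> (real ^ 'n) set" where
  "linearized_directions E I c x =
     {d. (\<forall>i\<in>E. d \<bullet> gradient (c i) x = 0) \<and>
         (\<forall>i\<in>active_set E I c x \<inter> I. d \<bullet> gradient (c i) x \<ge> 0)}"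

definition linear_constraint_qualification ::
  "'i set \<Rightarrow> 'i set \<Rightarrow> ('i \<Rightarrow> real ^ 'n \<Rightarrow> real) \<Rightarrow> real ^ 'n \<Rightarrow> bool" where
  "linear_constraint_qualification E I c x \<longleftrightarrow>
     (\<forall>i\<in>active_set E I c x. \<exists>a b. \<forall>y. c i y = a \<bullet> y + b)"

end

theory Submission
  imports Defs
begin

text \<open>
  An affine constraint that vanishes at \<open>x\<close> has no remainder in its first-order expansion:
  \<open>c\<^sub>i (x + h) = h \<bullet> \<nabla>c\<^sub>i(x)\<close> for every \<open>h\<close>, however large. Both inclusions follow from reading this
  identity in opposite directions.

  If \<open>d\<close> is tangent along \<open>z\<^sub>k\<close> and \<open>t\<^sub>k\<close>, the inner product of \<open>\<nabla>c\<^sub>i(x)\<close> with the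
  difference quotient \<open>(z\<^sub>k - x) / t\<^sub>k\<close> is \<open>c\<^sub>i (z\<^sub>k) / t\<^sub>k\<close>. Feasibility of \<open>z\<^sub>k\<close> makes it zero or
  nonnegative, and both conditions pass to the limit \<open>d\<close> (\<open>tangent_cone_linear_sign\<close>).

  Conversely, if \<open>d\<close> is a linearized direction, the ray \<open>x + s d\<close> (\<open>s > 0\<close>) satisfies all active
  constraints exactly. The inactive ones are positive at \<open>x\<close> and continuous there, and there are
  finitely many of them, so they stay positive for small \<open>s\<close>; the ray is then feasible near \<open>x\<close>
  and exhibits \<open>d\<close> as a tangent (\<open>ray_eventually_feasible_imp_tangent\<close>). For curved
  active constraints this fails: the ray along a linearized direction can be infeasible for every
  \<open>s > 0\<close>.
\<close>

lemma gradient_eqI: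
  assumes "GDERIV g x :> D"
  shows "gradient g x = D"
  unfolding gradient_def
proof (rule the_equality)
  fix D' assume "GDERIV g x :> D'"
  then have "(\<lambda>h. h \<bullet> D') = (\<lambda>h. h \<bullet> D)"
    using assms unfolding gderiv_def by (rule has_derivative_unique)
  then show "D' = D"
    by (simp add: fun_eq_iff vector_eq_ldot)
qed (fact assms)

lemma gradient_affine:
  assumes "\<And>y. g y = a \<bullet> y + b"
  shows "gradient g x = a"
proof (rule gradient_eqI)
  have "((\<lambda>y. a \<bullet> y + b) has_derivative (\<lambda>h. h \<bullet> a)) (at x)"
    by (auto intro!: derivative_eq_intros simp: inner_commute)
  moreover have "g = (\<lambda>y. a \<bullet> y + b)"
    using assms by (rule ext)
  ultimately show "GDERIV g x :> a"
    unfolding gderiv_def by simp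
qed

lemma affine_increment:
  assumes "\<And>y. g y = a \<bullet> y + b"
  shows "g y = g x + (y - x) \<bullet> gradient g x"
  by (simp only: gradient_affine[OF assms]) (simp add: assms inner_diff_left inner_commute[of a])

lemma active_constraint_expansion:
  assumes "x \<in> feasible_set E I c" and "linear_constraint_qualification E I c x"
    and "i \<in> active_set E I c x"
  shows "c i y = (y - x) \<bullet> gradient (c i) x"
proof -
  obtain a b where "\<And>y. c i y = a \<bullet> y + b"
    using assms(2,3) unfolding linear_constraint_qualification_def by blast
  then have "c i y = c i x + (y - x) \<bullet> gradient (c i) x"
    by (rule affine_increment)
  moreover have "c i x = 0"
    using assms(1,3) by (auto simp: active_set_def feasible_set_def)
  ultimately show ?thesis
    by simp
qed

text \<open>
  A half-space through the origin is a closed cone, so it contains every tangent vector as soon as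
  it contains all displacements from \<open>x\<close> to \<open>\<Omega>\<close>.
\<close>

lemma tangent_cone_linear_sign:
  assumes "d \<in> tangent_cone \<Omega> x" and "\<And>z. z \<in> \<Omega> \<Longrightarrow> (z - x) \<bullet> v \<ge> 0"
  shows "d \<bullet> v \<ge> 0"
proof -
  obtain z t where feas: "\<forall>\<^sub>F k in sequentially. z k \<in> \<Omega>" and pos: "\<And>k. t k > (0::real)"
    and lim: "(\<lambda>k. (z k - x) /\<^sub>R t k) \<longlonglongrightarrow> d"
    using assms(1) unfolding tangent_cone_def by blast
  have "(\<lambda>k. ((z k - x) /\<^sub>R t k) \<bullet> v) \<longlonglongrightarrow> d \<bullet> v"
    by (intro tendsto_inner lim tendsto_const)
  moreover have "\<forall>\<^sub>F k in sequentially. 0 \<le> ((z k - x) /\<^sub>R t k) \<bullet> v"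
    using feas
  proof eventually_elim
    case (elim k)
    then show ?case
      using assms(2) pos[of k] by simp
  qed
  ultimately show ?thesis
    by (rule tendsto_lowerbound) simp
qed

lemma ray_eventually_feasible_imp_tangent:
  assumes "\<forall>\<^sub>F s in at_right 0. x + s *\<^sub>R d \<in> \<Omega>"
  shows "d \<in> tangent_cone \<Omega> x"
proof -
  define t :: "nat \<Rightarrow> real" where "t k = inverse (real (Suc k))" for k
  define z where "z k = x + t k *\<^sub>R d" for k
  have pos: "t k > 0" for k
    by (simp add: t_def)
  have t0: "t \<longlonglongrightarrow> 0"
    unfolding t_def by (rule LIMSEQ_inverse_real_of_nat)
  have "filterlim t (at_right 0) sequentially"
    by (rule tendsto_imp_filterlim_at_right[OF t0]) (simp add: pos)
  then have "\<forall>\<^sub>F k in sequentially. z k \<in> \<Omega>"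
    using assms unfolding z_def filterlim_iff by blast
  moreover have "z \<longlonglongrightarrow> x"
    unfolding z_def by (auto intro!: tendsto_eq_intros t0)
  moreover have "(\<lambda>k. (z k - x) /\<^sub>R t k) = (\<lambda>k. d)"
    using pos by (simp add: z_def fun_eq_iff less_imp_neq[THEN not_sym])
  then have "(\<lambda>k. (z k - x) /\<^sub>R t k) \<longlonglongrightarrow> d"
    by simp
  ultimately show ?thesis
    unfolding tangent_cone_def using pos t0 by blast
qed

lemma continuously_differentiable_at_imp_isCont:
  "continuously_differentiable_at g x \<Longrightarrow> isCont g x"
  unfolding continuously_differentiable_at_def
  by (blast intro: differentiable_imp_continuous_within)

lemma positive_along_ray:
  fixes g :: "real ^ 'n \<Rightarrow> real"
  assumes "isCont g x" and "g x > 0"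
  shows "\<forall>\<^sub>F s in at_right 0. g (x + s *\<^sub>R d) > 0"
proof -
  have "((\<lambda>s. x + s *\<^sub>R d) \<longlongrightarrow> x) (at_right 0)"
    by (auto intro!: tendsto_eq_intros)
  then have "((\<lambda>s. g (x + s *\<^sub>R d)) \<longlongrightarrow> g x) (at_right 0)"
    by (rule isCont_tendsto_compose[OF assms(1)])
  then show ?thesis
    using assms(2) by (rule order_tendstoD)
qed

theorem theorem9:
  fixes f :: "real ^ 'n \<Rightarrow> real"
    and c :: "'i \<Rightarrow> real ^ 'n \<Rightarrow> real"
    and E I :: "'i set"
    and x :: "real ^ 'n"
  assumes "finite E" and "finite I" and "E \<inter> I = {}"
    and "x \<in> feasible_set E I c"
    and "\<And>i. i \<in> I - active_set E I c x \<Longrightarrow> continuously_differentiable_at (c i) x"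
    and "linear_constraint_qualification E I c x"
  shows "linearized_directions E I c x = tangent_cone (feasible_set E I c) x"
proof (intro equalityI subsetI)
  note expansion = active_constraint_expansion[OF assms(4,6)]
  fix d assume d: "d \<in> linearized_directions E I c x"
  have eq: "c i (x + s *\<^sub>R d) = 0" if "i \<in> E" for i s
    using that d expansion[of i] by (simp add: linearized_directions_def active_set_def)
  have "\<forall>\<^sub>F s in at_right 0. c i (x + s *\<^sub>R d) \<ge> 0" if "i \<in> I" for i
  proof (cases "i \<in> active_set E I c x")
    case True
    then have "c i (x + s *\<^sub>R d) \<ge> 0" if "s > 0" for s
      using that \<open>i \<in> I\<close> d expansion[of i] by (simp add: linearized_directions_def)
    then show ?thesis
      by (rule eventually_mono[OF eventually_at_right_less])
  next
    case False
    then have "c i x > 0"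
      using \<open>i \<in> I\<close> assms(4) by (force simp: active_set_def feasible_set_def)
    moreover have "isCont (c i) x"
      using False \<open>i \<in> I\<close> assms(5) by (blast intro: continuously_differentiable_at_imp_isCont)
    ultimately have "\<forall>\<^sub>F s in at_right 0. c i (x + s *\<^sub>R d) > 0"
      by (intro positive_along_ray)
    then show ?thesis
      by (rule eventually_mono) simp
  qed
  then have "\<forall>\<^sub>F s in at_right 0. \<forall>i\<in>I. c i (x + s *\<^sub>R d) \<ge> 0"
    using \<open>finite I\<close> by (simp add: eventually_ball_finite)
  then have "\<forall>\<^sub>F s in at_right 0. x + s *\<^sub>R d \<in> feasible_set E I c"
    by (rule eventually_mono) (simp add: feasible_set_def eq)
  then show "d \<in> tangent_cone (feasible_set E I c) x"
    by (rule ray_eventually_feasible_imp_tangent)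
next
  note expansion = active_constraint_expansion[OF assms(4,6), symmetric]
  fix d assume d: "d \<in> tangent_cone (feasible_set E I c) x"
  have "d \<bullet> gradient (c i) x = 0" if "i \<in> E" for i
  proof (rule antisym)
    have act: "i \<in> active_set E I c x"
      using that by (simp add: active_set_def)
    have zero: "(z - x) \<bullet> gradient (c i) x = 0" if "z \<in> feasible_set E I c" for z
      using that \<open>i \<in> E\<close> by (simp add: expansion[OF act] feasible_set_def)
    show "d \<bullet> gradient (c i) x \<ge> 0"
      by (rule tangent_cone_linear_sign[OF d]) (simp add: zero)
    have "d \<bullet> (- gradient (c i) x) \<ge> 0"
      by (rule tangent_cone_linear_sign[OF d]) (simp add: zero)
    then show "d \<bullet> gradient (c i) x \<le> 0"
      by simp
  qed
  moreover have "d \<bullet> gradient (c i) x \<ge> 0" if "i \<in> active_set E I c x \<inter> I" for i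
  proof (rule tangent_cone_linear_sign[OF d])
    fix z assume "z \<in> feasible_set E I c"
    then show "(z - x) \<bullet> gradient (c i) x \<ge> 0"
      using that by (simp add: expansion feasible_set_def)
  qed
  ultimately show "d \<in> linearized_directions E I c x"
    by (simp add: linearized_directions_def)
qed

end
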